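(* Let $\mathcal H$ be a separable Hilbert space, $J$ a countable index set, and let $F=\{f_j\}_{j\in J}$ and $G=\{g_j\}_{j\in J}$ be two Bessel sequences for $\mathcal H$ with synthesis operators $T_F$ and $T_G$. Suppose that $I_{\mathcal H}=T_FT_G^*=T_GT_F^*$ and that for every $\sigma\subset J$, $T_F^{\sigma}(T_G^{\sigma})^*=T_G^{\sigma}(T_F^{\sigma})^*$. Then $F$ and $G$ are woven frames for $\mathcal H$.
   Context: A sequence $\{f_j\}_{j\in J}$ in $\mathcal H$ is a frame with bounds $A,B>0$ if $A\|f\|^2\le\sum_{j\in J}|\langle f,f_j\rangle|^2\le B\|f\|^2$ for all $f\in\mathcal H$; it is a Bessel sequence with bound $B$ if the upper inequality holds. The synthesis operator of a Bessel sequence $F$ is $T_F:\ell^2(J)\to\mathcal H$, $T_F(\{c_j\})=\sum_{j\in J}c_jf_j$. For $\sigma\subset J$ the truncated synthesis operator is $T_F^\sigma(\{c_j\})=\sum_{j\in\sigma}c_jf_j$, so that $T_F^\sigma(T_G^\sigma)^*f=\sum_{j\in\sigma}\langle f,g_j\rangle f_j$. $F$ and $G$ are woven if there are constants $A,B>0$ such that for every $\sigma\subset J$ the family $\{f_j\}_{j\in\sigma}\cup\{g_j\}_{j\in\sigma^c}$ (as an indexed family over $J$, $\sigma^c=J\setminus\sigma$) is a frame for $\mathcal H$ with bounds $A$ and $B$. $I_{\mathcal H}$ is the identity operator. *)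

theory Defs
  imports "HOL-Analysis.Analysis"
begin

text \<open>A commutative normed division algebra over the reals is isometrically isomorphic to
  the reals or to the complex numbers, and the third axiom determines the conjugation. So this class
  treats real and complex Hilbert spaces uniformly.\<close>

class conj_field = real_normed_field +
  fixes conjg :: "'a \<Rightarrow> 'a"
  assumes conjg_add: "conjg (x + y) = conjg x + conjg y"
    and conjg_mult: "conjg (x * y) = conjg x * conjg y"
    and mult_conjg: "x * conjg x = (norm x)\<^sup>2 *\<^sub>R 1"

instantiation real :: conj_field
begin
definition conjg_real :: "real \<Rightarrow> real" where "conjg_real x = x"
instance by standard (auto simp: conjg_real_def power2_eq_square)
end

instantiation complex :: conj_field
begin
definition conjg_complex :: "complex \<Rightarrow> complex" where "conjg_complex = cnj"
instance by standard (auto simp: conjg_complex_def scaleR_conv_of_real simp flip: complex_norm_square)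
end

text \<open>The sort \<open>banach\<close> supplies completeness and the topology; the last two axioms say that the
  norm and the real structure of the type are those of the Hilbert space. The inner product is linear
  in the first argument.\<close>

locale hilbert_space = vector_space smul
  for smul :: "'k::conj_field \<Rightarrow> 'v::banach \<Rightarrow> 'v" +
  fixes ip :: "'v \<Rightarrow> 'v \<Rightarrow> 'k"
  assumes ip_add_left: "ip (x + y) z = ip x z + ip y z"
    and ip_smul_left: "ip (smul c x) y = c * ip x y"
    and ip_commute: "ip y x = conjg (ip x y)"
    and ip_self: "ip x x = of_real ((norm x)\<^sup>2)"
    and smul_of_real: "smul (of_real r) x = r *\<^sub>R x"

lemma hilbert_space_real:
  "hilbert_space (scaleR :: real \<Rightarrow> 'v \<Rightarrow> 'v::{banach, real_inner}) inner"
  by unfold_locales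
    (auto simp: algebra_simps inner_commute conjg_real_def power2_norm_eq_inner)

lemma hilbert_space_complex: "hilbert_space ((*) :: complex \<Rightarrow> _) (\<lambda>x y. x * cnj y)"
  by unfold_locales
    (auto simp: algebra_simps conjg_complex_def scaleR_conv_of_real simp flip: complex_norm_square)

definition frame :: "('v::banach \<Rightarrow> 'v \<Rightarrow> 'k::conj_field) \<Rightarrow> 'j set \<Rightarrow> ('j \<Rightarrow> 'v) \<Rightarrow> real \<Rightarrow> real \<Rightarrow> bool"
  where "frame ip J f A B \<longleftrightarrow> A > 0 \<and> B > 0 \<and>
    (\<forall>x. (\<lambda>j. (norm (ip x (f j)))\<^sup>2) summable_on J \<and>
         A * (norm x)\<^sup>2 \<le> (\<Sum>\<^sub>\<infinity>j\<in>J. (norm (ip x (f j)))\<^sup>2) \<and>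
         (\<Sum>\<^sub>\<infinity>j\<in>J. (norm (ip x (f j)))\<^sup>2) \<le> B * (norm x)\<^sup>2)"

definition bessel :: "('v::banach \<Rightarrow> 'v \<Rightarrow> 'k::conj_field) \<Rightarrow> 'j set \<Rightarrow> ('j \<Rightarrow> 'v) \<Rightarrow> real \<Rightarrow> bool"
  where "bessel ip J f B \<longleftrightarrow> B > 0 \<and>
    (\<forall>x. (\<lambda>j. (norm (ip x (f j)))\<^sup>2) summable_on J \<and>
         (\<Sum>\<^sub>\<infinity>j\<in>J. (norm (ip x (f j)))\<^sup>2) \<le> B * (norm x)\<^sup>2)"

text \<open>Elements of \<open>l2 J\<close> are total functions, normalized to be 0 outside \<open>J\<close>.\<close>

definition l2 :: "'j set \<Rightarrow> ('j \<Rightarrow> 'k::conj_field) set"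
  where "l2 J = {c. (\<forall>j. j \<notin> J \<longrightarrow> c j = 0) \<and> (\<lambda>j. (norm (c j))\<^sup>2) summable_on J}"

definition l2_ip :: "'j set \<Rightarrow> ('j \<Rightarrow> 'k::conj_field) \<Rightarrow> ('j \<Rightarrow> 'k) \<Rightarrow> 'k"
  where "l2_ip J c d = (\<Sum>\<^sub>\<infinity>j\<in>J. c j * conjg (d j))"

text \<open>The truncated synthesis operator; \<open>\<sigma> = J\<close> gives the synthesis operator itself. For every
  \<open>\<sigma> \<subseteq> J\<close> its domain is \<open>l2 J\<close>.\<close>

definition synthesis :: "('k::conj_field \<Rightarrow> 'v::banach \<Rightarrow> 'v) \<Rightarrow> 'j set \<Rightarrow> ('j \<Rightarrow> 'v) \<Rightarrow> ('j \<Rightarrow> 'k) \<Rightarrow> 'v"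
  where "synthesis smul \<sigma> f c = (\<Sum>\<^sub>\<infinity>j\<in>\<sigma>. smul (c j) (f j))"

text \<open>The Hilbert space adjoint of an operator from \<open>l2 J\<close> to the Hilbert space.\<close>

definition adjoint_l2 ::
    "('v::banach \<Rightarrow> 'v \<Rightarrow> 'k::conj_field) \<Rightarrow> 'j set \<Rightarrow> (('j \<Rightarrow> 'k) \<Rightarrow> 'v) \<Rightarrow> 'v \<Rightarrow> 'j \<Rightarrow> 'k"
  where "adjoint_l2 ip J T x = (THE d. d \<in> l2 J \<and> (\<forall>c\<in>l2 J. ip (T c) x = l2_ip J c d))"

definition woven :: "('v::banach \<Rightarrow> 'v \<Rightarrow> 'k::conj_field) \<Rightarrow> 'j set \<Rightarrow> ('j \<Rightarrow> 'v) \<Rightarrow> ('j \<Rightarrow> 'v) \<Rightarrow> bool"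
  where "woven ip J f g \<longleftrightarrow>
    (\<exists>A>0. \<exists>B>0. \<forall>\<sigma>\<subseteq>J. frame ip J (\<lambda>j. if j \<in> \<sigma> then f j else g j) A B)"

end

theory Submission
  imports Defs
begin

text \<open>From \<open>T\<^sub>F T\<^sub>G\<^sup>* = I\<close> we get \<open>\<parallel>x\<parallel>\<^sup>2 = \<Sum>\<^sub>j \<langle>x, g\<^sub>j\<rangle> \<langle>f\<^sub>j, x\<rangle>\<close>. For \<open>\<sigma> \<subseteq> J\<close> let \<open>h\<close> be the weaving
  that takes \<open>f\<close> on \<open>\<sigma>\<close> and \<open>g\<close> elsewhere, and let \<open>k\<close> be the complementary weaving. Termwise
  \<open>\<bar>\<langle>x, g\<^sub>j\<rangle> \<langle>f\<^sub>j, x\<rangle>\<bar> = \<bar>\<langle>x, h\<^sub>j\<rangle>\<bar> \<bar>\<langle>x, k\<^sub>j\<rangle>\<bar>\<close>, so Cauchy-Schwarz and the Bessel bound of \<open>k\<close> give a lower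
  frame bound for \<open>h\<close> that does not depend on \<open>\<sigma>\<close>.\<close>

section \<open>Conjugation in the scalar field\<close>

lemma conjg_0: "conjg 0 = (0 :: 'k::conj_field)"
  using conjg_add[of 0 "0 :: 'k"] by simp

lemma conjg_of_real: "conjg (of_real r) = (of_real r :: 'k::conj_field)"
proof (cases "r = 0")
  case True
  then show ?thesis by (simp add: conjg_0)
next
  case False
  have "of_real r * conjg (of_real r) = (of_real r * of_real r :: 'k)"
    using mult_conjg[of "of_real r :: 'k"] by (simp add: scaleR_conv_of_real power2_eq_square)
  then show ?thesis using False by simp
qed

text \<open>By additivity it suffices that the kernel is trivial, and \<open>z * conjg z\<close>
  determines the norm of \<open>z\<close>.\<close>

lemma conjg_inject:
  assumes "conjg x = conjg (y :: 'k::conj_field)" shows "x = y"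
proof -
  have "conjg x = conjg (x - y) + conjg y" using conjg_add[of "x - y" y] by simp
  then have "conjg (x - y) = 0" using assms by simp
  then show ?thesis using mult_conjg[of "x - y"] by simp
qed

lemma norm_conjg: "norm (conjg x) = norm (x :: 'k::conj_field)"
proof (cases "x = 0")
  case True
  then show ?thesis by (simp add: conjg_0)
next
  case False
  have "norm x * norm (conjg x) = norm x * norm x"
    using mult_conjg[of x] by (simp add: power2_eq_square flip: norm_mult)
  then show ?thesis using False by simp
qed

section \<open>Cancellation in the reals and convergence of unordered sums\<close>

lemma le_if_mult_self_le:
  fixes s K :: real
  assumes "s * s \<le> K * s" "K \<ge> 0" "s \<ge> 0"
  shows "s \<le> K"
  using assms by (cases "s = 0") (auto simp: mult_le_cancel_right)

text \<open>A Cauchy criterion: far out in the net of finite subsets the sums of \<open>p\<close>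
  over differences of sets are small, hence so are those of \<open>u\<close>, and completeness gives
  a limit. Norms of individual terms need not be summable.\<close>

lemma summable_on_if_norm_sum_sq_le:
  fixes u :: "'j \<Rightarrow> 'v::banach" and p :: "'j \<Rightarrow> real"
  assumes p: "p summable_on J" and B: "B > 0"
    and le: "\<And>F. finite F \<Longrightarrow> F \<subseteq> J \<Longrightarrow> (norm (sum u F))\<^sup>2 \<le> B * sum p F"
  shows "u summable_on J"
proof -
  obtain S where S: "(sum p \<longlongrightarrow> S) (finite_subsets_at_top J)"
    using p by (auto simp: summable_on_def has_sum_def)
  have "\<exists>P. eventually P (finite_subsets_at_top J) \<and>
      (\<forall>F F'. P F \<and> P F' \<longrightarrow> dist (sum u F) (sum u F') < e)" if "e > 0" for e
  proof -
    \<comment> \<open>Two partial sums of \<open>p\<close> within \<open>d\<close> of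
      \<open>S\<close> differ by less than \<open>2 * d\<close>, and \<open>B * (2 * d)\<close> is
      exactly \<open>(e / 2)\<^sup>2\<close>.\<close>
    define d where "d = (e / 2)\<^sup>2 / (2 * B)"
    have d: "d > 0" using B that by (simp add: d_def)
    then have "\<forall>\<^sub>F F in finite_subsets_at_top J. dist (sum p F) S < d"
      using S by (simp add: tendsto_iff)
    then obtain F0 where F0: "finite F0" "F0 \<subseteq> J"
      and near: "\<And>F. finite F \<Longrightarrow> F0 \<subseteq> F \<Longrightarrow> F \<subseteq> J \<Longrightarrow> dist (sum p F) S < d"
      by (auto simp: eventually_finite_subsets_at_top)
    \<comment> \<open>Sets containing \<open>F0\<close> are compared with \<open>F0\<close> first,
      where the difference is again a finite subset of \<open>J\<close>; the triangle inequality
      through \<open>F0\<close> then yields \<open>e\<close>.\<close>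
    have half: "dist (sum u F) (sum u F0) < e / 2" if F: "finite F" "F0 \<subseteq> F" "F \<subseteq> J" for F
    proof -
      have "(dist (sum u F) (sum u F0))\<^sup>2 = (norm (sum u (F - F0)))\<^sup>2"
        using F by (simp add: dist_norm sum_diff)
      also have "\<dots> \<le> B * (sum p F - sum p F0)"
        using le[of "F - F0"] F by (auto simp: sum_diff)
      also have "\<dots> < B * (2 * d)"
        using near[OF F] near[of F0] F0 B by (auto simp: dist_real_def)
      also have "\<dots> = (e / 2)\<^sup>2" using B by (simp add: d_def)
      finally show ?thesis using \<open>e > 0\<close> power2_less_imp_less by fastforce
    qed
    have "eventually (\<lambda>F. finite F \<and> F0 \<subseteq> F \<and> F \<subseteq> J) (finite_subsets_at_top J)"
      using F0 by (auto simp: eventually_finite_subsets_at_top)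
    moreover have "dist (sum u F) (sum u F') < e"
      if "finite F \<and> F0 \<subseteq> F \<and> F \<subseteq> J" "finite F' \<and> F0 \<subseteq> F' \<and> F' \<subseteq> J" for F F'
      using half[of F] half[of F'] that dist_triangle2[of "sum u F" "sum u F'" "sum u F0"] by simp
    ultimately show ?thesis
      by (intro exI[of _ "\<lambda>F. finite F \<and> F0 \<subseteq> F \<and> F \<subseteq> J"]) blast
  qed
  then have "cauchy_filter (filtermap (sum u) (finite_subsets_at_top J))"
    by (simp add: cauchy_filter_metric_filtermap)
  then have "convergent_filter (filtermap (sum u) (finite_subsets_at_top J))"
    by (rule cauchy_filter_convergent)
  then show ?thesis
    by (auto simp: convergent_filter_iff summable_on_def has_sum_def filterlim_def)
qed

section \<open>Inner product and synthesis operators of Bessel sequences\<close>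

context hilbert_space
begin

text \<open>Cauchy-Schwarz follows by projecting \<open>x\<close> onto the line through
  \<open>y\<close>. It makes the inner product continuous in its first argument, so that it can be
  exchanged with infinite sums.\<close>

lemma ip_bounded_linear: "bounded_linear (\<lambda>x. ip x y)"
  and norm_ip_le: "norm (ip x y) \<le> norm x * norm y"
proof -
  show le: "norm (ip x y) \<le> norm x * norm y" for x y
  proof (cases "y = 0")
    case True
    have "ip y x = 0" using ip_smul_left[of 0 y x] True by simp
    then show ?thesis using True ip_commute[of x y] by (simp add: conjg_0)
  next
    case False
    \<comment> \<open>\<open>smul c y\<close> is the orthogonal projection of \<open>x\<close> onto
      \<open>y\<close>, and \<open>z\<close> is the remainder.\<close>
    define c where "c = ip x y / of_real ((norm y)\<^sup>2)"
    define z where "z = x - smul c y"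
    have x: "x = z + smul c y" by (simp add: z_def)
    have "ip x y = ip z y + c * of_real ((norm y)\<^sup>2)"
      by (subst x) (simp only: ip_add_left ip_smul_left ip_self)
    then have zy: "ip z y = 0" using False by (simp add: c_def)
    then have yz: "ip y z = 0" using ip_commute[of y z] by (simp add: conjg_0)
    have "ip x z = ip z z" by (subst x) (simp only: ip_add_left ip_smul_left yz mult_zero_right add_0_right)
    then have zx: "ip z x = of_real ((norm z)\<^sup>2)"
      using ip_commute[of z x] by (simp only: ip_self conjg_of_real)
    have "c * ip y x = of_real ((norm (ip x y))\<^sup>2 / (norm y)\<^sup>2)"
      using mult_conjg[of "ip x y"] ip_commute[of y x]
      by (simp add: c_def scaleR_conv_of_real)
    moreover have "ip x x = ip z x + c * ip y x"
      by (subst (1) x) (simp only: ip_add_left ip_smul_left)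
    \<comment> \<open>Pythagoras for \<open>x = z + smul c y\<close>, stated in the scalar field and
      then pulled back to the reals.\<close>
    ultimately have "(of_real ((norm x)\<^sup>2) :: 'k)
        = of_real ((norm z)\<^sup>2 + (norm (ip x y))\<^sup>2 / (norm y)\<^sup>2)"
      by (simp only: zx ip_self of_real_add)
    then have "(norm x)\<^sup>2 = (norm z)\<^sup>2 + (norm (ip x y))\<^sup>2 / (norm y)\<^sup>2"
      by (simp only: of_real_eq_iff)
    then have "(norm (ip x y))\<^sup>2 / (norm y)\<^sup>2 \<le> (norm x)\<^sup>2" by simp
    then have "(norm (ip x y))\<^sup>2 \<le> (norm x * norm y)\<^sup>2"
      using False by (simp add: divide_le_eq power_mult_distrib)
    then show ?thesis by (rule power2_le_imp_le) simp
  qed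
  show "bounded_linear (\<lambda>x. ip x y)"
  proof (rule bounded_linear_intro)
    show "ip (r *\<^sub>R x) y = r *\<^sub>R ip x y" for r x
      by (simp add: ip_smul_left scaleR_conv_of_real flip: smul_of_real)
    show "norm (ip x y) \<le> norm x * norm y" for x by (rule le)
  qed (rule ip_add_left)
qed

lemma ip_sum_smul: "ip (\<Sum>j\<in>F. smul (c j) (f j)) x = (\<Sum>j\<in>F. c j * ip (f j) x)"
  by (simp add: linear_sum[OF bounded_linear.linear[OF ip_bounded_linear]] ip_smul_left)

lemma norm_ip_commute: "norm (ip y x) = norm (ip x y)"
  using ip_commute[of y x] by (simp add: norm_conjg)

lemma bessel_finite_sum_le:
  assumes "bessel ip J f B" "finite F" "F \<subseteq> J"
  shows "(\<Sum>j\<in>F. (norm (ip x (f j)))\<^sup>2) \<le> B * (norm x)\<^sup>2"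
proof -
  have "(\<Sum>j\<in>F. (norm (ip x (f j)))\<^sup>2) \<le> (\<Sum>\<^sub>\<infinity>j\<in>J. (norm (ip x (f j)))\<^sup>2)"
    using assms by (intro finite_sum_le_infsum) (auto simp: bessel_def)
  also have "\<dots> \<le> B * (norm x)\<^sup>2" using assms(1) by (simp add: bessel_def)
  finally show ?thesis .
qed

text \<open>Duality: pairing the sum \<open>y\<close> with itself and using Cauchy-Schwarz leaves
  the Bessel inequality at \<open>y\<close>, after which one factor \<open>(norm y)\<^sup>2\<close>
  cancels.\<close>

lemma bessel_norm_sum_sq_le:
  assumes f: "bessel ip J f B" and F: "finite F" "F \<subseteq> J"
  shows "(norm (\<Sum>j\<in>F. smul (c j) (f j)))\<^sup>2 \<le> B * (\<Sum>j\<in>F. (norm (c j))\<^sup>2)"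
proof -
  define y where "y = (\<Sum>j\<in>F. smul (c j) (f j))"
  have "(norm y)\<^sup>2 = norm (ip y y)" by (simp only: ip_self norm_of_real) simp
  also have "\<dots> = norm (\<Sum>j\<in>F. c j * ip (f j) y)"
    \<comment> \<open>Only the first argument is expanded; the second stays \<open>y\<close>, the
      vector at which the Bessel inequality is used.\<close>
    by (subst (1) y_def) (simp only: ip_sum_smul)
  also have "\<dots> \<le> (\<Sum>j\<in>F. norm (c j) * norm (ip y (f j)))"
    by (rule order_trans[OF norm_sum]) (simp add: norm_mult norm_ip_commute)
  finally have "((norm y)\<^sup>2)\<^sup>2 \<le> (\<Sum>j\<in>F. norm (c j) * norm (ip y (f j)))\<^sup>2"
    by (rule power_mono) simp
  also have "\<dots> \<le> (\<Sum>j\<in>F. (norm (c j))\<^sup>2) * (\<Sum>j\<in>F. (norm (ip y (f j)))\<^sup>2)"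
    by (rule Cauchy_Schwarz_ineq_sum)
  also have "\<dots> \<le> (\<Sum>j\<in>F. (norm (c j))\<^sup>2) * (B * (norm y)\<^sup>2)"
    by (intro mult_left_mono bessel_finite_sum_le[OF f F] sum_nonneg) simp
  finally have "(norm y)\<^sup>2 * (norm y)\<^sup>2 \<le> (B * (\<Sum>j\<in>F. (norm (c j))\<^sup>2)) * (norm y)\<^sup>2"
    by (simp add: power2_eq_square mult_ac)
  moreover have "B * (\<Sum>j\<in>F. (norm (c j))\<^sup>2) \<ge> 0"
    using f by (auto simp: bessel_def intro!: mult_nonneg_nonneg sum_nonneg)
  ultimately have "(norm y)\<^sup>2 \<le> B * (\<Sum>j\<in>F. (norm (c j))\<^sup>2)"
    by (rule le_if_mult_self_le) simp
  then show ?thesis by (simp add: y_def)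
qed

lemma bessel_summable_on:
  assumes "bessel ip J f B" "(\<lambda>j. (norm (c j))\<^sup>2) summable_on J"
  shows "(\<lambda>j. smul (c j) (f j)) summable_on J"
  using assms(2) by (rule summable_on_if_norm_sum_sq_le)
    (use assms(1) in \<open>auto simp: bessel_def intro: bessel_norm_sum_sq_le[OF assms(1)]\<close>)

lemma has_sum_ip_synthesis:
  assumes "bessel ip J f B" "(\<lambda>j. (norm (c j))\<^sup>2) summable_on J"
  shows "((\<lambda>j. c j * ip (f j) x) has_sum ip (synthesis smul J f c) x) J"
  using has_sum_bounded_linear[OF ip_bounded_linear has_sum_infsum[OF bessel_summable_on[OF assms]]]
  by (simp add: synthesis_def ip_smul_left)

text \<open>The adjoint of synthesis is analysis. The definite description needs both existence, by
  exchanging inner product and sum, and uniqueness, by testing on unit vectors; the value 0 outside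
  \<open>J\<close> is the normalization in \<open>l2\<close>.\<close>

lemma adjoint_synthesis:
  assumes f: "bessel ip J f B"
  shows "adjoint_l2 ip J (synthesis smul J f) x = (\<lambda>j. if j \<in> J then ip x (f j) else 0)"
proof -
  define a where "a = (\<lambda>j. if j \<in> J then ip x (f j) else 0)"
  have "(\<lambda>j. (norm (a j))\<^sup>2) summable_on J \<longleftrightarrow> (\<lambda>j. (norm (ip x (f j)))\<^sup>2) summable_on J"
    by (rule summable_on_cong) (simp add: a_def)
  then have a: "a \<in> l2 J" using f by (auto simp: l2_def bessel_def a_def)
  have eq: "ip (synthesis smul J f c) x = l2_ip J c a" if "c \<in> l2 J" for c
  proof -
    have "ip (synthesis smul J f c) x = (\<Sum>\<^sub>\<infinity>j\<in>J. c j * ip (f j) x)"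
      using has_sum_ip_synthesis[OF f, of c x] that by (simp add: l2_def infsumI)
    also have "\<dots> = l2_ip J c a"
      unfolding l2_ip_def by (rule infsum_cong) (simp add: a_def flip: ip_commute)
    finally show ?thesis .
  qed
  have uniq: "d = a" if d: "d \<in> l2 J" "\<forall>c\<in>l2 J. ip (synthesis smul J f c) x = l2_ip J c d" for d
  proof
    fix i
    show "d i = a i"
    proof (cases "i \<in> J")
      case False
      then show ?thesis using d a by (simp add: l2_def)
    next
      case True
      \<comment> \<open>Pairing with the unit vector at \<open>i\<close> reads off the conjugate of
        the \<open>i\<close>-th coordinate.\<close>
      define e where "e = (\<lambda>j. if j = i then 1 else 0 :: 'k)"
      have "(\<lambda>j. (norm (e j))\<^sup>2) summable_on J \<longleftrightarrow> (\<lambda>j. (norm (e j))\<^sup>2) summable_on {i}"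
        using True by (intro summable_on_cong_neutral) (auto simp: e_def)
      then have e: "e \<in> l2 J" using True by (auto simp: l2_def e_def)
      have l2: "l2_ip J e b = conjg (b i)" for b
      proof -
        have "l2_ip J e b = (\<Sum>\<^sub>\<infinity>j\<in>{i}. e j * conjg (b j))"
          unfolding l2_ip_def using True by (intro infsum_cong_neutral) (auto simp: e_def)
        then show ?thesis by (simp add: e_def)
      qed
      have "l2_ip J e d = l2_ip J e a" using d(2) eq e by metis
      then show ?thesis by (auto simp: l2 intro: conjg_inject)
    qed
  qed
  have "(THE d. d \<in> l2 J \<and> (\<forall>c\<in>l2 J. ip (synthesis smul J f c) x = l2_ip J c d)) = a"
    using a eq uniq by (intro the_equality) blast+
  then show ?thesis unfolding adjoint_l2_def a_def .
qed

text \<open>The identity reconstructs \<open>x\<close> by synthesis with \<open>f\<close> from its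
  coefficients against \<open>g\<close>; pairing this expansion with \<open>x\<close> gives the
  sum.\<close>

lemma has_sum_norm_sq_if_dual:
  assumes f: "bessel ip J f B" and g: "bessel ip J g C"
    and id: "synthesis smul J f \<circ> adjoint_l2 ip J (synthesis smul J g) = id"
  shows "((\<lambda>j. ip x (g j) * ip (f j) x) has_sum of_real ((norm x)\<^sup>2)) J"
proof -
  define a where "a = (\<lambda>j. if j \<in> J then ip x (g j) else 0)"
  have x: "synthesis smul J f a = x"
    using fun_cong[OF id, of x] by (simp add: adjoint_synthesis[OF g] a_def)
  have "(\<lambda>j. (norm (a j))\<^sup>2) summable_on J \<longleftrightarrow> (\<lambda>j. (norm (ip x (g j)))\<^sup>2) summable_on J"
    by (rule summable_on_cong) (simp add: a_def)
  then have "(\<lambda>j. (norm (a j))\<^sup>2) summable_on J" using g by (simp add: bessel_def)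
  then have "((\<lambda>j. a j * ip (f j) x) has_sum of_real ((norm x)\<^sup>2)) J"
    using has_sum_ip_synthesis[OF f, of a x] by (simp only: x ip_self)
  then show ?thesis by (rule has_sum_cong[THEN iffD1, rotated]) (simp add: a_def)
qed

section \<open>Frame bounds of weavings\<close>

lemma bessel_weave:
  assumes f: "bessel ip J f B" and g: "bessel ip J g C"
  shows "bessel ip J (\<lambda>j. if j \<in> \<sigma> then f j else g j) (B + C)"
  unfolding bessel_def
proof (intro conjI allI)
  show "B + C > 0" using f g by (simp add: bessel_def)
  fix x
  define h where "h = (\<lambda>j. if j \<in> \<sigma> then f j else g j)"
  have bound: "(\<Sum>j\<in>F. (norm (ip x (h j)))\<^sup>2) \<le> (B + C) * (norm x)\<^sup>2"
    if F: "finite F" "F \<subseteq> J" for F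
  proof -
    \<comment> \<open>Each term of the weaving is one of the two summands on the right, which makes
      the bound independent of \<open>\<sigma>\<close>.\<close>
    have "(\<Sum>j\<in>F. (norm (ip x (h j)))\<^sup>2)
        \<le> (\<Sum>j\<in>F. (norm (ip x (f j)))\<^sup>2 + (norm (ip x (g j)))\<^sup>2)"
      by (rule sum_mono) (simp add: h_def)
    also have "\<dots> \<le> (B + C) * (norm x)\<^sup>2"
      using bessel_finite_sum_le[OF f F] bessel_finite_sum_le[OF g F]
      by (simp add: sum.distrib distrib_right add_mono)
    finally show ?thesis .
  qed
  show sm: "(\<lambda>j. (norm (ip x (if j \<in> \<sigma> then f j else g j)))\<^sup>2) summable_on J"
    by (rule nonneg_bdd_above_summable_on)
      (auto intro!: bdd_aboveI2[where M = "(B + C) * (norm x)\<^sup>2"] bound[unfolded h_def])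
  show "(\<Sum>\<^sub>\<infinity>j\<in>J. (norm (ip x (if j \<in> \<sigma> then f j else g j)))\<^sup>2) \<le> (B + C) * (norm x)\<^sup>2"
    using sm by (rule infsum_le_finite_sums) (rule bound[unfolded h_def])
qed

lemma frame_weave_if_dual:
  assumes f: "bessel ip J f B" and g: "bessel ip J g C"
    and id: "synthesis smul J f \<circ> adjoint_l2 ip J (synthesis smul J g) = id"
  shows "frame ip J (\<lambda>j. if j \<in> \<sigma> then f j else g j) (1 / (B + C)) (B + C)"
proof -
  define h where "h = (\<lambda>j. if j \<in> \<sigma> then f j else g j)"
  define k where "k = (\<lambda>j. if j \<in> \<sigma> then g j else f j)"
  have pos: "B + C > 0" using f g by (simp add: bessel_def)
  have h: "bessel ip J h (B + C)" unfolding h_def by (rule bessel_weave[OF f g])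
  \<comment> \<open>\<open>k\<close> is the weaving over the same \<open>\<sigma>\<close> with
    \<open>f\<close> and \<open>g\<close> exchanged.\<close>
  have k: "bessel ip J k (B + C)"
    using bessel_weave[OF g f] unfolding k_def by (simp add: add.commute)
  have "(norm x)\<^sup>2 \<le> (B + C) * (\<Sum>\<^sub>\<infinity>j\<in>J. (norm (ip x (h j)))\<^sup>2)" for x
  proof -
    define W where "W = (\<Sum>\<^sub>\<infinity>j\<in>J. (norm (ip x (h j)))\<^sup>2)"
    have W: "W \<ge> 0" unfolding W_def by (rule infsum_nonneg) simp
    have fin: "norm (\<Sum>j\<in>F. ip x (g j) * ip (f j) x) \<le> sqrt (W * ((B + C) * (norm x)\<^sup>2))"
      if F: "finite F" "F \<subseteq> J" for F
    proof -
      have "norm (\<Sum>j\<in>F. ip x (g j) * ip (f j) x)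
          \<le> (\<Sum>j\<in>F. norm (ip x (h j)) * norm (ip x (k j)))"
        by (rule order_trans[OF norm_sum])
          (auto simp: norm_mult norm_ip_commute h_def k_def mult.commute intro!: sum_mono)
      then have "(norm (\<Sum>j\<in>F. ip x (g j) * ip (f j) x))\<^sup>2
          \<le> (\<Sum>j\<in>F. norm (ip x (h j)) * norm (ip x (k j)))\<^sup>2"
        by (rule power_mono) simp
      also have "\<dots> \<le> (\<Sum>j\<in>F. (norm (ip x (h j)))\<^sup>2) * (\<Sum>j\<in>F. (norm (ip x (k j)))\<^sup>2)"
        by (rule Cauchy_Schwarz_ineq_sum)
      \<comment> \<open>The factor from \<open>h\<close> is enlarged to its full sum
        \<open>W\<close>, the quantity to be bounded below; the factor from \<open>k\<close> is
        absorbed by its Bessel bound.\<close>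
      also have "\<dots> \<le> W * ((B + C) * (norm x)\<^sup>2)"
        using F h W unfolding W_def
        by (intro mult_mono bessel_finite_sum_le[OF k] finite_sum_le_infsum sum_nonneg)
          (auto simp: bessel_def)
      finally show ?thesis by (rule real_le_rsqrt)
    qed
    \<comment> \<open>The estimate \<open>fin\<close> is uniform in \<open>F\<close>, so it survives
      the limit over finite subsets of \<open>J\<close>.\<close>
    have "((\<lambda>F. norm (\<Sum>j\<in>F. ip x (g j) * ip (f j) x)) \<longlongrightarrow> norm (of_real ((norm x)\<^sup>2) :: 'k))
        (finite_subsets_at_top J)"
      using has_sum_norm_sq_if_dual[OF f g id, of x] unfolding has_sum_def by (rule tendsto_norm)
    then have "norm (of_real ((norm x)\<^sup>2) :: 'k) \<le> sqrt (W * ((B + C) * (norm x)\<^sup>2))"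
      by (rule tendsto_upperbound) (auto intro: eventually_finite_subsets_at_top_weakI fin)
    then have "((norm x)\<^sup>2)\<^sup>2 \<le> (sqrt (W * ((B + C) * (norm x)\<^sup>2)))\<^sup>2"
      by (intro power_mono) (simp_all only: norm_of_real, simp_all)
    also have "\<dots> = W * ((B + C) * (norm x)\<^sup>2)" using W pos by simp
    finally have "(norm x)\<^sup>2 * (norm x)\<^sup>2 \<le> ((B + C) * W) * (norm x)\<^sup>2"
      by (simp add: power2_eq_square mult_ac)
    \<comment> \<open>Cancelling \<open>(norm x)\<^sup>2\<close> this way also covers
      \<open>x = 0\<close>.\<close>
    then show ?thesis unfolding W_def[symmetric] by (rule le_if_mult_self_le) (use W pos in auto)
  qed
  then have "1 / (B + C) * (norm x)\<^sup>2 \<le> (\<Sum>\<^sub>\<infinity>j\<in>J. (norm (ip x (h j)))\<^sup>2)" for x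
    using pos by (simp add: divide_le_eq mult.commute)
  then show ?thesis using h pos unfolding frame_def bessel_def h_def by simp
qed

end

theorem theorem2p5:
  fixes smul :: "'k::conj_field \<Rightarrow> 'v::banach \<Rightarrow> 'v"
    and ip :: "'v \<Rightarrow> 'v \<Rightarrow> 'k"
    and J :: "'j set"
    and f g :: "'j \<Rightarrow> 'v"
  assumes "hilbert_space smul ip"
    and "separable_space (euclidean :: 'v topology)"
    and "countable J"
    and "\<exists>B. bessel ip J f B"
    and "\<exists>B. bessel ip J g B"
    and "synthesis smul J f \<circ> adjoint_l2 ip J (synthesis smul J g) = id"
    and "synthesis smul J g \<circ> adjoint_l2 ip J (synthesis smul J f) = id"
    and "\<And>\<sigma>. \<sigma> \<subseteq> J \<Longrightarrow>
      synthesis smul \<sigma> f \<circ> adjoint_l2 ip J (synthesis smul \<sigma> g) =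
      synthesis smul \<sigma> g \<circ> adjoint_l2 ip J (synthesis smul \<sigma> f)"
  shows "(\<exists>A B. frame ip J f A B) \<and> (\<exists>A B. frame ip J g A B) \<and> woven ip J f g"
proof -
  interpret hilbert_space smul ip by fact
  obtain B C where f: "bessel ip J f B" and g: "bessel ip J g C" using assms(4,5) by blast
  note weave = frame_weave_if_dual[OF f g assms(6)]
  \<comment> \<open>The weaving over \<open>UNIV\<close> is \<open>f\<close> itself, and the one
    over the empty set is \<open>g\<close>.\<close>
  have "frame ip J f (1 / (B + C)) (B + C)" using weave[of UNIV] by simp
  moreover have "frame ip J g (1 / (B + C)) (B + C)" using weave[of "{}"] by simp
  moreover have "B + C > 0" using f g by (simp add: bessel_def)
  then have "woven ip J f g"
    unfolding woven_def using weave
    by (intro exI[of _ "1 / (B + C)"] conjI exI[of _ "B + C"]) auto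
  ultimately show ?thesis by blast
qed

end
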